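(* Let $n\in\mathbb N$, $1\le p<\infty$, $p<r\le\infty$ and $0<\kappa<1$. Then the following statements hold. (1) If $r<\infty$ and $f\in LM^{p,r;\kappa}(\mathbb R^n)\cap L^\infty(\mathbb R^n)$, then for every $q$ with $r<q<\infty$ we have $f\in M^{q;\kappa}(\mathbb R^n)$, and $$\|f\|_{M^{q;\kappa}}\le 2\cdot\big(\|f\|_{LM^{p,r;\kappa}}\big)^{p/q}\cdot\big(\|f\|_{L^\infty}\big)^{1-p/q}.$$ (2) If $r=\infty$ and $f\in LM^{p,\infty;\kappa}(\mathbb R^n)\cap L^\infty(\mathbb R^n)$, then for every $q$ with $p<q<\infty$ we have $f\in M^{q;\kappa}(\mathbb R^n)$, and $$\|f\|_{M^{q;\kappa}}\le \Big[2^{1-1/q}\Big(\frac{q}{q-p}\Big)^{1/q}\Big]\cdot\big(\|f\|_{LM^{p,\infty;\kappa}}\big)^{p/q}\cdot\big(\|f\|_{L^\infty}\big)^{1-p/q}.$$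
   Context: $\mathbb R^n$ carries Lebesgue measure $m$. For a ball $B\subset\mathbb R^n$ and measurable $f$ on $\mathbb R^n$, let $d_{f;B}(\lambda)=m(\{x\in B:|f(x)|>\lambda\})$ for $\lambda>0$ and $f^*_B(t)=\inf\{\lambda>0:d_{f;B}(\lambda)\le t\}$ for $t>0$ (the non-increasing rearrangement of $f\mathbf 1_B$). For $1\le p<\infty$, $1\le r\le\infty$, put $\|f\|_{L^{p,r}(B)}=\big(\int_0^\infty[s^{1/p}f_B^*(s)]^r\frac{ds}{s}\big)^{1/r}$ if $r<\infty$ and $\|f\|_{L^{p,\infty}(B)}=\sup_{s>0}s^{1/p}f_B^*(s)$. For $0<\kappa<1$, the Lorentz--Morrey space $LM^{p,r;\kappa}(\mathbb R^n)$ is the set of measurable $f$ on $\mathbb R^n$ with $\|f\|_{LM^{p,r;\kappa}}=\sup_B m(B)^{-\kappa/p}\|f\|_{L^{p,r}(B)}<\infty$, and the Morrey space $M^{q;\kappa}(\mathbb R^n)$ ($1\le q<\infty$) is the set of locally integrable $f$ with $\|f\|_{M^{q;\kappa}}=\sup_B\big(m(B)^{-\kappa}\int_B|f(y)|^q\,dy\big)^{1/q}<\infty$; both suprema are over all balls $B\subset\mathbb R^n$. *)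

theory Defs
  imports "HOL-Analysis.Analysis" "HOL-Probability.Essential_Supremum"
begin

text \<open>
  All (quasi-)norms take values in \<open>ennreal\<close>, so that they are defined for every function and
  finiteness is a genuine condition. The codomain class \<open>{real_normed_field, euclidean_space}\<close>
  covers both scalar fields, \<open>real\<close> and \<open>complex\<close>.
\<close>

text \<open>Powers of extended nonnegative reals; only used with exponents \<open>a > 0\<close>.\<close>

definition epowr :: "ennreal \<Rightarrow> real \<Rightarrow> ennreal" (infixr \<open>epowr\<close> 80) where
  "x epowr a = (if x = \<infinity> then \<infinity> else ennreal (enn2real x powr a))"

definition balls :: "(real ^ 'n) set set" where
  "balls = {ball c \<rho> | c \<rho>. 0 < \<rho>}"

definition distr_on :: "(real ^ 'n) set \<Rightarrow> (real ^ 'n \<Rightarrow> 'b::real_normed_vector) \<Rightarrow> real \<Rightarrow> ennreal" where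
  "distr_on B f a = emeasure lebesgue {x \<in> B. norm (f x) > a}"

definition rearr_on :: "(real ^ 'n) set \<Rightarrow> (real ^ 'n \<Rightarrow> 'b::real_normed_vector) \<Rightarrow> real \<Rightarrow> ennreal" where
  "rearr_on B f t = Inf {ennreal a | a. 0 < a \<and> distr_on B f a \<le> ennreal t}"

definition lorentz_norm ::
  "real \<Rightarrow> ereal \<Rightarrow> (real ^ 'n) set \<Rightarrow> (real ^ 'n \<Rightarrow> 'b::real_normed_vector) \<Rightarrow> ennreal" where
  "lorentz_norm p r B f =
     (if r = \<infinity> then SUP s\<in>{0<..}. ennreal (s powr (1 / p)) * rearr_on B f s
      else (\<integral>\<^sup>+ s\<in>{0<..}. ((ennreal (s powr (1 / p)) * rearr_on B f s) epowr real_of_ereal r)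
              * ennreal (1 / s) \<partial>lborel) epowr (1 / real_of_ereal r))"

definition lorentz_morrey_norm ::
  "real \<Rightarrow> ereal \<Rightarrow> real \<Rightarrow> (real ^ 'n \<Rightarrow> 'b::real_normed_vector) \<Rightarrow> ennreal" where
  "lorentz_morrey_norm p r \<kappa> f =
     (SUP B\<in>balls. ennreal (measure lebesgue B powr (- (\<kappa> / p))) * lorentz_norm p r B f)"

definition lorentz_morrey_space ::
  "real \<Rightarrow> ereal \<Rightarrow> real \<Rightarrow> (real ^ 'n \<Rightarrow> 'b::{real_normed_field, euclidean_space}) set" where
  "lorentz_morrey_space p r \<kappa> =
     {f. f \<in> borel_measurable lebesgue \<and> lorentz_morrey_norm p r \<kappa> f < \<infinity>}"

definition locally_integrable ::
  "(real ^ 'n \<Rightarrow> 'b::{real_normed_field, euclidean_space}) \<Rightarrow> bool" where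
  "locally_integrable f \<longleftrightarrow> (\<forall>K. compact K \<longrightarrow> set_integrable lebesgue K f)"

definition morrey_norm ::
  "real \<Rightarrow> real \<Rightarrow> (real ^ 'n \<Rightarrow> 'b::real_normed_vector) \<Rightarrow> ennreal" where
  "morrey_norm q \<kappa> f =
     (SUP B\<in>balls. (ennreal (measure lebesgue B powr (- \<kappa>))
        * (\<integral>\<^sup>+ y\<in>B. ennreal (norm (f y) powr q) \<partial>lebesgue)) epowr (1 / q))"

definition morrey_space ::
  "real \<Rightarrow> real \<Rightarrow> (real ^ 'n \<Rightarrow> 'b::{real_normed_field, euclidean_space}) set" where
  "morrey_space q \<kappa> = {f. locally_integrable f \<and> morrey_norm q \<kappa> f < \<infinity>}"

definition Linfty_norm :: "(real ^ 'n \<Rightarrow> 'b::real_normed_vector) \<Rightarrow> ennreal" where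
  "Linfty_norm f = esssup lebesgue (\<lambda>x. ennreal (norm (f x)))"

definition Linfty_space :: "(real ^ 'n \<Rightarrow> 'b::{real_normed_field, euclidean_space}) set" where
  "Linfty_space = {f. f \<in> borel_measurable lebesgue \<and> Linfty_norm f < \<infinity>}"

end

theory Submission
  imports Defs
begin

text \<open>
  Write \<open>M\<close> for the essential supremum of \<open>f\<close>, \<open>N\<close> for its Lorentz--Morrey norm and \<open>f\<^sup>*\<close> for the
  rearrangement of \<open>f\<close> on a ball \<open>B\<close>. Then \<open>f\<^sup>* \<le> M\<close>, the Lorentz norm of \<open>f\<close> on \<open>B\<close> is at most
  \<open>A = N * m(B) powr (\<kappa> / p)\<close>, and comparing distribution functions bounds the integral of \<open>|f|^q\<close>
  over \<open>B\<close> by that of \<open>(f\<^sup>*)^q\<close> over the half-line (\<open>nn_integral_powr_le_rearr_on\<close>).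

  The half-line is split at a point \<open>t > 0\<close>. On \<open>(0, t]\<close> the bound \<open>f\<^sup>* \<le> M\<close> gives \<open>M^q * t\<close>.
  On \<open>(t, \<infinity>)\<close> the two cases differ. If \<open>r < \<infinity>\<close>, then \<open>f\<^sup>*(s)^q \<le> M^(q-r) * f\<^sup>*(s)^r\<close> and
  \<open>1 \<le> (s/t)^(r/p-1)\<close>, so the integral is at most \<open>M^(q-r) * A^r * t^(1-r/p)\<close>
  (\<open>nn_integral_powr_le_split\<close>). If \<open>r = \<infinity>\<close>, then \<open>f\<^sup>*(s) \<le> A * s^(-1/p)\<close>, whose \<open>q\<close>-th power
  integrates to \<open>p/(q-p) * A^q * t^(1-q/p)\<close> (\<open>nn_integral_powr_le_split_weak\<close>).

  The choice \<open>t = (A/M)^p\<close> balances the two terms: both become multiples of \<open>A^p * M^(q-p)\<close>, with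
  factors adding up to \<open>2\<close> and to \<open>q/(q-p)\<close> respectively (\<open>le_of_split_bounds\<close>). Since
  \<open>A^p = N^p * m(B)^\<kappa>\<close>, the dependence on \<open>B\<close> cancels in the Morrey norm, and \<open>q\<close>-th roots give
  the estimates with the constants \<open>2^(1/q)\<close> and \<open>(q/(q-p))^(1/q)\<close>, which are at most the
  claimed ones because \<open>q \<ge> 1\<close>.
\<close>

section \<open>Powers of extended nonnegative reals\<close>

lemma ennreal_epowr: "0 \<le> x \<Longrightarrow> ennreal x epowr a = ennreal (x powr a)"
  by (simp add: epowr_def)

lemma epowr_inverse_le_iff:
  assumes "0 < a" "0 \<le> y"
  shows "x epowr (1 / a) \<le> ennreal y \<longleftrightarrow> x \<le> ennreal (y powr a)"
proof (cases x)
  case (real z)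
  have "z powr (1 / a) \<le> y \<longleftrightarrow> z \<le> y powr a"
  proof
    assume "z powr (1 / a) \<le> y"
    then have "(z powr (1 / a)) powr a \<le> y powr a"
      using assms by (intro powr_mono2) auto
    then show "z \<le> y powr a" using assms real by (simp add: powr_powr)
  next
    assume "z \<le> y powr a"
    then have "z powr (1 / a) \<le> (y powr a) powr (1 / a)"
      using assms real by (intro powr_mono2) auto
    then show "z powr (1 / a) \<le> y" using assms by (simp add: powr_powr)
  qed
  then show ?thesis using real assms by (simp add: ennreal_epowr)
qed (auto simp: epowr_def top.extremum_unique)

section \<open>Rearrangements and the distribution function\<close>

lemma nn_integral_layer_cake:
  assumes "sigma_finite_measure M" and g [measurable]: "g \<in> borel_measurable M"
  shows "(\<integral>\<^sup>+ x. g x \<partial>M) = (\<integral>\<^sup>+ a\<in>{0<..}. emeasure M {x \<in> space M. ennreal a < g x} \<partial>lborel)"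
proof -
  interpret M: sigma_finite_measure M by fact
  interpret pair_sigma_finite M lborel ..
  have slice: "(\<integral>\<^sup>+ a. indicator {a. 0 < a \<and> ennreal a < y} a \<partial>lborel) = y" for y :: ennreal
  proof (cases y)
    case (real z)
    then have "{a. 0 < a \<and> ennreal a < y} = {0<..<z}"
      by (auto simp: ennreal_less_iff)
    then show ?thesis using real by simp
  next
    case top
    then have "{a. 0 < a \<and> ennreal a < y} = {0<..}" by auto
    moreover have "emeasure lborel {0::real<..} = top"
    proof (rule ccontr)
      assume "emeasure lborel {0::real<..} \<noteq> top"
      then obtain n where n: "emeasure lborel {0::real<..} < of_nat n"
        using ennreal_Ex_less_of_nat by (auto simp: less_top)
      have "emeasure lborel {0<..real n} \<le> emeasure lborel {0::real<..}"
        by (intro emeasure_mono) auto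
      with n show False by (simp add: ennreal_of_nat_eq_real_of_nat)
    qed
    ultimately show ?thesis using top by simp
  qed
  have "(\<integral>\<^sup>+ x. g x \<partial>M)
      = (\<integral>\<^sup>+ x. (\<integral>\<^sup>+ a. indicator {a. 0 < a \<and> ennreal a < g x} a \<partial>lborel) \<partial>M)"
    by (simp only: slice)
  also have "\<dots> = (\<integral>\<^sup>+ a. (\<integral>\<^sup>+ x. indicator {a. 0 < a \<and> ennreal a < g x} a \<partial>M) \<partial>lborel)"
    by (rule Fubini'[symmetric]) (unfold indicator_def mem_Collect_eq, measurable)
  also have "\<dots> = (\<integral>\<^sup>+ a\<in>{0<..}. emeasure M {x \<in> space M. ennreal a < g x} \<partial>lborel)"
  proof (rule nn_integral_cong)
    fix a :: real
    have "(\<integral>\<^sup>+ x. indicator {a. 0 < a \<and> ennreal a < g x} a \<partial>M)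
        = (\<integral>\<^sup>+ x. indicator {0<..} a * indicator {x \<in> space M. ennreal a < g x} x \<partial>M)"
      by (rule nn_integral_cong) (auto split: split_indicator)
    also have "\<dots> = emeasure M {x \<in> space M. ennreal a < g x} * indicator {0<..} a"
      by (subst nn_integral_cmult) (auto simp: mult.commute)
    finally show "(\<integral>\<^sup>+ x. indicator {a. 0 < a \<and> ennreal a < g x} a \<partial>M) = \<dots>" .
  qed
  finally show ?thesis .
qed

text \<open>Only heights \<open>a > 0\<close> matter, so the superlevel sets at \<open>0\<close> need not be compared.\<close>

lemma nn_integral_le_of_distribution_le:
  assumes "sigma_finite_measure M" "sigma_finite_measure N"
    and "g \<in> borel_measurable M" "h \<in> borel_measurable N"
    and "\<And>a. 0 < a \<Longrightarrow> emeasure M {x \<in> space M. ennreal a < g x}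
                       \<le> emeasure N {x \<in> space N. ennreal a < h x}"
  shows "(\<integral>\<^sup>+ x. g x \<partial>M) \<le> (\<integral>\<^sup>+ x. h x \<partial>N)"
  unfolding nn_integral_layer_cake[OF assms(1,3)] nn_integral_layer_cake[OF assms(2,4)]
  using assms(5) by (intro nn_integral_mono) (auto split: split_indicator)

lemma sigma_finite_lebesgue: "sigma_finite_measure (lebesgue :: 'a::euclidean_space measure)"
proof -
  obtain A :: "'a set set" where A: "countable A" "A \<subseteq> sets lborel" "\<Union>A = UNIV"
      "\<forall>a\<in>A. emeasure lborel a \<noteq> \<infinity>"
    using lborel.sigma_finite_countable by auto
  show ?thesis
    by standard (rule exI[of _ A], use A in \<open>auto simp: subset_iff\<close>)
qed

lemma distr_on_antimono:
  assumes "B \<in> sets lebesgue" "f \<in> borel_measurable lebesgue" "a \<le> b"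
  shows "distr_on B f b \<le> distr_on B f a"
  unfolding distr_on_def using assms by (intro emeasure_mono) auto

text \<open>
  The Galois-type duality between a rearrangement and its distribution function. It yields the
  measurability of the rearrangement, its bound by the essential supremum, and the measure of its
  superlevel sets. Both sides remain meaningful for \<open>s \<le> 0\<close>, where \<open>ennreal s = 0\<close>.
\<close>

lemma less_rearr_on_iff:
  fixes f :: "real ^ 'n \<Rightarrow> 'b::{real_normed_field, euclidean_space}"
  assumes B: "B \<in> sets lebesgue" and f: "f \<in> borel_measurable lebesgue" and a: "0 \<le> a"
  shows "ennreal a < rearr_on B f s \<longleftrightarrow> ennreal s < distr_on B f a"
proof
  assume less: "ennreal a < rearr_on B f s"
  show "ennreal s < distr_on B f a"
  proof (rule ccontr)
    assume "\<not> ennreal s < distr_on B f a"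
    then have "distr_on B f a \<le> ennreal s" by simp
    then have "rearr_on B f s \<le> ennreal (a + e)" if "0 < e" for e
    proof -
      have "distr_on B f (a + e) \<le> distr_on B f a"
        using that by (intro distr_on_antimono[OF B f]) simp
      then have "distr_on B f (a + e) \<le> ennreal s"
        using \<open>distr_on B f a \<le> ennreal s\<close> by (rule order_trans)
      moreover have "0 < a + e" using a that by simp
      ultimately show ?thesis
        unfolding rearr_on_def by (blast intro: Inf_lower)
    qed
    then have "rearr_on B f s \<le> ennreal a"
      using a by - (rule ennreal_le_epsilon, simp)
    with less show False by simp
  qed
next
  assume less: "ennreal s < distr_on B f a"
  \<comment> \<open>Right-continuity of the distribution function: the superlevel set at height \<open>a\<close> is the
    increasing union of those at heights \<open>a + 1/(n+1)\<close>.\<close>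
  define E where "E n = {x \<in> B. norm (f x) > a + 1 / real (Suc n)}" for n
  have E: "range E \<subseteq> sets lebesgue" using B f unfolding E_def by auto
  have "incseq E"
    unfolding E_def incseq_def
    by (auto elim!: le_less_trans[rotated] simp: frac_le)
  moreover have "(\<Union>n. E n) = {x \<in> B. norm (f x) > a}"
  proof (intro equalityI subsetI)
    fix x assume x: "x \<in> {x \<in> B. norm (f x) > a}"
    then obtain n where "inverse (real (Suc n)) < norm (f x) - a"
      using reals_Archimedean[of "norm (f x) - a"] by auto
    then show "x \<in> (\<Union>n. E n)"
      using x by (auto simp: E_def inverse_eq_divide intro!: exI[of _ n])
  next
    fix x assume "x \<in> (\<Union>n. E n)"
    then obtain n where "x \<in> B" "norm (f x) > a + 1 / real (Suc n)" by (auto simp: E_def)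
    moreover have "0 < 1 / real (Suc n)" by simp
    ultimately have "a < norm (f x)" by linarith
    then show "x \<in> {x \<in> B. norm (f x) > a}" using \<open>x \<in> B\<close> by simp
  qed
  ultimately have "distr_on B f a = (SUP n. emeasure lebesgue (E n))"
    using SUP_emeasure_incseq[OF E] by (simp add: distr_on_def)
  with less obtain n where "ennreal s < emeasure lebesgue (E n)"
    by (metis less_SUP_iff)
  then have n: "ennreal s < distr_on B f (a + 1 / real (Suc n))"
    by (simp only: distr_on_def E_def)
  have "ennreal a < ennreal (a + 1 / real (Suc n))"
    using a by (intro ennreal_lessI) (auto intro: add_nonneg_pos)
  also have "\<dots> \<le> rearr_on B f s"
    unfolding rearr_on_def
  proof (rule Inf_greatest, clarify)
    fix b :: real assume b: "0 < b" "distr_on B f b \<le> ennreal s"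
    have "a + 1 / real (Suc n) \<le> b"
    proof (rule ccontr)
      assume "\<not> a + 1 / real (Suc n) \<le> b"
      then have "distr_on B f (a + 1 / real (Suc n)) \<le> distr_on B f b"
        by (intro distr_on_antimono[OF B f]) auto
      then show False using n b by auto
    qed
    then show "ennreal (a + 1 / real (Suc n)) \<le> ennreal b" by (rule ennreal_leI)
  qed
  finally show "ennreal a < rearr_on B f s" .
qed

lemma borel_measurable_rearr_on:
  fixes f :: "real ^ 'n \<Rightarrow> 'b::{real_normed_field, euclidean_space}"
  assumes "B \<in> sets lebesgue" "f \<in> borel_measurable lebesgue"
  shows "rearr_on B f \<in> borel_measurable borel"
proof (rule borel_measurableI_greater)
  fix y :: ennreal
  show "{s \<in> space borel. y < rearr_on B f s} \<in> sets borel"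
  proof (cases y)
    case (real a)
    then have "{s \<in> space borel. y < rearr_on B f s} = {s \<in> space borel. ennreal s < distr_on B f a}"
      by (simp only: less_rearr_on_iff[OF assms])
    also have "\<dots> \<in> sets borel" by measurable
    finally show ?thesis .
  qed simp
qed

lemma rearr_on_le:
  fixes f :: "real ^ 'n \<Rightarrow> 'b::{real_normed_field, euclidean_space}"
  assumes "B \<in> sets lebesgue" "f \<in> borel_measurable lebesgue" "0 \<le> M"
    and bound: "AE x in lebesgue. norm (f x) \<le> M"
  shows "rearr_on B f s \<le> ennreal M"
proof -
  have "AE x in lebesgue. \<not> (x \<in> B \<and> norm (f x) > M)"
    using bound by eventually_elim auto
  then have "distr_on B f M = 0"
    unfolding distr_on_def using assms by (subst (asm) AE_iff_measurable[OF _ refl]) auto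
  then show ?thesis
    using less_rearr_on_iff[OF assms(1-3), of s] by (simp add: not_less[symmetric])
qed

lemma rearr_on_realE:
  fixes f :: "real ^ 'n \<Rightarrow> 'b::{real_normed_field, euclidean_space}"
  assumes B: "B \<in> sets lebesgue" and f: "f \<in> borel_measurable lebesgue" and "0 \<le> M"
    and bound: "AE x in lebesgue. norm (f x) \<le> M"
  obtains H :: "real \<Rightarrow> real" where "H \<in> borel_measurable borel"
    and "\<And>s. 0 \<le> H s" and "\<And>s. rearr_on B f s = ennreal (H s)" and "\<And>s. H s \<le> M"
proof
  fix s
  have "rearr_on B f s \<le> ennreal M"
    using rearr_on_le[OF assms] .
  moreover from this have "rearr_on B f s < top"
    by (rule le_less_trans) simp
  ultimately show "rearr_on B f s = ennreal (enn2real (rearr_on B f s))"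
    and "enn2real (rearr_on B f s) \<le> M"
    using \<open>0 \<le> M\<close> by (auto simp: enn2real_leI)
next
  show "(\<lambda>s. enn2real (rearr_on B f s)) \<in> borel_measurable borel"
    using borel_measurable_rearr_on[OF B f] by measurable
qed simp

text \<open>
  One half of the equimeasurability of \<open>f\<close> on \<open>B\<close> and its rearrangement; the superlevel set of
  \<open>f\<^sup>*\<close> at height \<open>b > 0\<close> is the interval from \<open>0\<close> to the value of the distribution function at \<open>b\<close>.
\<close>

lemma nn_integral_powr_le_rearr_on:
  fixes f :: "real ^ 'n \<Rightarrow> 'b::{real_normed_field, euclidean_space}"
  assumes B: "B \<in> sets lebesgue" and fin: "emeasure lebesgue B < \<infinity>"
    and f [measurable]: "f \<in> borel_measurable lebesgue" and "0 < q"
    and bounded: "\<And>s. rearr_on B f s < \<infinity>"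
  shows "(\<integral>\<^sup>+ y\<in>B. ennreal (norm (f y) powr q) \<partial>lebesgue)
       \<le> (\<integral>\<^sup>+ s\<in>{0<..}. ennreal (enn2real (rearr_on B f s) powr q) \<partial>lborel)"
proof (rule nn_integral_le_of_distribution_le[OF sigma_finite_lebesgue sigma_finite_lborel])
  note [measurable] = B borel_measurable_rearr_on[OF B f]
  show "(\<lambda>y. ennreal (norm (f y) powr q) * indicator B y) \<in> borel_measurable lebesgue"
    by measurable
  show "(\<lambda>s. ennreal (enn2real (rearr_on B f s) powr q) * indicator {0<..} s)
      \<in> borel_measurable lborel"
    by measurable
  fix a :: real assume "0 < a"
  define b where "b = a powr (1 / q)"
  have b: "0 < b" "a = b powr q"
    using \<open>0 < a\<close> \<open>0 < q\<close> by (auto simp: b_def powr_powr)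
  have level: "ennreal a < ennreal (x powr q) \<longleftrightarrow> b < x" if "0 \<le> x" for x
    using that b \<open>0 < q\<close> powr_less_mono2[of q b x] powr_mono2[of q x b]
    by (auto simp: ennreal_less_iff not_less[symmetric])
  have "distr_on B f b \<le> emeasure lebesgue B"
    unfolding distr_on_def by (intro emeasure_mono) (auto simp: B)
  then have "distr_on B f b < \<infinity>" using fin by (rule le_less_trans)
  then obtain d where d: "distr_on B f b = ennreal d" "0 \<le> d"
    by (cases "distr_on B f b") auto
  have "{y \<in> space lebesgue. ennreal a < ennreal (norm (f y) powr q) * indicator B y}
      = {y \<in> B. norm (f y) > b}"
    using level by (auto split: split_indicator)
  moreover have "{s \<in> space lborel. ennreal a < ennreal (enn2real (rearr_on B f s) powr q)
      * indicator {0<..} s} = {0<..<d}"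
  proof -
    have "b < enn2real (rearr_on B f s) \<longleftrightarrow> ennreal s < ennreal d" for s
    proof -
      have "b < enn2real (rearr_on B f s) \<longleftrightarrow> ennreal b < rearr_on B f s"
        using bounded[of s] b(1) by (cases "rearr_on B f s") (auto simp: ennreal_less_iff)
      then show ?thesis using less_rearr_on_iff[OF B f, of b s] b(1) d by simp
    qed
    then have "ennreal a < ennreal (enn2real (rearr_on B f s) powr q) * indicator {0<..} s
        \<longleftrightarrow> 0 < s \<and> s < d" for s
      using level[of "enn2real (rearr_on B f s)"]
      by (cases "0 < s") (simp_all add: ennreal_less_iff)
    then show ?thesis by (simp add: greaterThanLessThan_eq Int_def)
  qed
  ultimately show "emeasure lebesgue
        {y \<in> space lebesgue. ennreal a < ennreal (norm (f y) powr q) * indicator B y}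
      \<le> emeasure lborel {s \<in> space lborel. ennreal a <
          ennreal (enn2real (rearr_on B f s) powr q) * indicator {0<..} s}"
    using d by (simp add: distr_on_def)
qed

section \<open>One-dimensional estimates\<close>

text \<open>The finite-exponent case: \<open>A\<close> bounds the Lorentz norm of \<open>H\<close> with exponents \<open>p\<close> and \<open>r\<close>.\<close>

lemma nn_integral_powr_le_split:
  fixes H :: "real \<Rightarrow> real"
  assumes [measurable]: "H \<in> borel_measurable borel"
    and H: "\<And>s. 0 \<le> H s" "\<And>s. H s \<le> M"
    and "0 < p" "p < r" "r < q" "0 < t" "0 \<le> A"
    and L: "(\<integral>\<^sup>+ s\<in>{0<..}. ennreal ((s powr (1 / p) * H s) powr r) * ennreal (1 / s) \<partial>lborel)
            \<le> ennreal (A powr r)"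
  shows "(\<integral>\<^sup>+ s\<in>{0<..}. ennreal (H s powr q) \<partial>lborel)
       \<le> ennreal (M powr q * t + M powr (q - r) * A powr r * t powr (1 - r / p))"
proof -
  have M: "0 \<le> M" using H[of 0] by linarith
  let ?c = "M powr (q - r) * t powr (1 - r / p)"
  have "(\<integral>\<^sup>+ s\<in>{0<..}. ennreal (H s powr q) \<partial>lborel)
     \<le> (\<integral>\<^sup>+ s. ennreal (M powr q) * indicator {0..t} s + ennreal ?c *
           (ennreal ((s powr (1 / p) * H s) powr r) * ennreal (1 / s) * indicator {0<..} s) \<partial>lborel)"
  proof (rule nn_integral_mono)
    fix s :: real
    consider "s \<le> 0" | "0 < s" "s \<le> t" | "t < s" by linarith
    then show "ennreal (H s powr q) * indicator {0<..} s \<le> ennreal (M powr q) * indicator {0..t} s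
      + ennreal ?c * (ennreal ((s powr (1 / p) * H s) powr r) * ennreal (1 / s) * indicator {0<..} s)"
    proof cases
      case 2
      have "ennreal (H s powr q) \<le> ennreal (M powr q)"
        using H assms by (intro ennreal_leI powr_mono2) auto
      then show ?thesis using 2 by (simp add: add_increasing2)
    next
      case 3
      then have s: "0 < s" using \<open>0 < t\<close> by simp
      have "H s powr q = H s powr (q - r) * H s powr r"
        by (simp flip: powr_add)
      also have "\<dots> \<le> M powr (q - r) * H s powr r"
        using H assms by (intro mult_right_mono powr_mono2) auto
      also have "\<dots> \<le> (M powr (q - r) * H s powr r) * (t powr (1 - r / p) * s powr (r / p - 1))"
      proof -
        have "1 = t powr (1 - r / p) * t powr (r / p - 1)"
          using \<open>0 < t\<close> by (simp flip: powr_add)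
        also have "\<dots> \<le> t powr (1 - r / p) * s powr (r / p - 1)"
          using assms 3 by (intro mult_left_mono powr_mono2) auto
        finally show ?thesis
          using mult_left_mono[of 1 _ "M powr (q - r) * H s powr r"] by simp
      qed
      also have "\<dots> = ?c * ((s powr (1 / p) * H s) powr r * (1 / s))"
      proof -
        have "(s powr (1 / p) * H s) powr r * (1 / s) = H s powr r * s powr (r / p - 1)"
          using s H by (simp add: powr_mult powr_powr powr_diff)
        then show ?thesis by (simp add: mult_ac)
      qed
      finally have "ennreal (H s powr q) \<le> ennreal (?c * ((s powr (1 / p) * H s) powr r * (1 / s)))"
        by (rule ennreal_leI)
      also have "\<dots> = ennreal ?c * (ennreal ((s powr (1 / p) * H s) powr r) * ennreal (1 / s))"
        using s by (subst ennreal_mult) (auto simp flip: ennreal_mult)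
      finally show ?thesis using 3 s by simp
    qed auto
  qed
  also have "\<dots> = ennreal (M powr q) * ennreal t + ennreal ?c *
      (\<integral>\<^sup>+ s\<in>{0<..}. ennreal ((s powr (1 / p) * H s) powr r) * ennreal (1 / s) \<partial>lborel)"
    using \<open>0 < t\<close> by (subst nn_integral_add) (auto simp: nn_integral_cmult)
  also have "\<dots> \<le> ennreal (M powr q) * ennreal t + ennreal ?c * ennreal (A powr r)"
    by (intro add_mono mult_left_mono L) auto
  also have "\<dots> = ennreal (M powr q * t + M powr (q - r) * A powr r * t powr (1 - r / p))"
    using \<open>0 < t\<close> by (simp add: ennreal_mult[symmetric] mult_ac flip: ennreal_plus)
  finally show ?thesis .
qed

text \<open>The case of exponent \<open>\<infinity>\<close>: \<open>A\<close> bounds the weak Lorentz norm of \<open>H\<close>.\<close>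

lemma nn_integral_powr_le_split_weak:
  fixes H :: "real \<Rightarrow> real"
  assumes [measurable]: "H \<in> borel_measurable borel"
    and H: "\<And>s. 0 \<le> H s" "\<And>s. H s \<le> M"
    and "0 < p" "p < q" "0 < t" "0 \<le> A"
    and L: "\<And>s. 0 < s \<Longrightarrow> s powr (1 / p) * H s \<le> A"
  shows "(\<integral>\<^sup>+ s\<in>{0<..}. ennreal (H s powr q) \<partial>lborel)
       \<le> ennreal (M powr q * t + p / (q - p) * A powr q * t powr (1 - q / p))"
proof -
  have M: "0 \<le> M" using H[of 0] by linarith
  have "(\<integral>\<^sup>+ s\<in>{0<..}. ennreal (H s powr q) \<partial>lborel)
     \<le> (\<integral>\<^sup>+ s. ennreal (M powr q) * indicator {0..t} s
            + ennreal (A powr q) * (ennreal (s powr (- (q / p))) * indicator {t..} s) \<partial>lborel)"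
  proof (rule nn_integral_mono)
    fix s :: real
    consider "s \<le> 0" | "0 < s" "s \<le> t" | "t < s" by linarith
    then show "ennreal (H s powr q) * indicator {0<..} s \<le> ennreal (M powr q) * indicator {0..t} s
        + ennreal (A powr q) * (ennreal (s powr (- (q / p))) * indicator {t..} s)"
    proof cases
      case 2
      have "ennreal (H s powr q) \<le> ennreal (M powr q)"
        using H assms by (intro ennreal_leI powr_mono2) auto
      then show ?thesis using 2 by (simp add: add_increasing2)
    next
      case 3
      then have s: "0 < s" using \<open>0 < t\<close> by simp
      have "H s = s powr (1 / p) * H s * s powr (- (1 / p))"
        using s by (simp add: powr_minus)
      also have "\<dots> \<le> A * s powr (- (1 / p))"
        using L[OF s] by (intro mult_right_mono) auto
      finally have "H s powr q \<le> (A * s powr (- (1 / p))) powr q"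
        using H assms by (intro powr_mono2) auto
      also have "\<dots> = A powr q * s powr (- (q / p))"
        using \<open>0 \<le> A\<close> by (simp add: powr_mult powr_powr)
      finally have "ennreal (H s powr q) \<le> ennreal (A powr q * s powr (- (q / p)))"
        by (rule ennreal_leI)
      then show ?thesis using 3 s by (simp add: ennreal_mult)
    qed auto
  qed
  also have "\<dots> = ennreal (M powr q) * ennreal t + ennreal (A powr q) *
      (\<integral>\<^sup>+ s. ennreal (s powr (- (q / p))) * indicator {t..} s \<partial>lborel)"
    using \<open>0 < t\<close> by (subst nn_integral_add) (auto simp: nn_integral_cmult)
  also have "(\<integral>\<^sup>+ s. ennreal (s powr (- (q / p))) * indicator {t..} s \<partial>lborel)
      = ennreal (0 - t powr (1 - q / p) / (1 - q / p))"
  proof (rule nn_integral_FTC_atLeast)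
    fix s assume "t \<le> s"
    then have "0 < s" using \<open>0 < t\<close> by simp
    then have "((\<lambda>s. s powr (1 - q / p) / (1 - q / p)) has_real_derivative
        (1 - q / p) * s powr (1 - q / p - 1) / (1 - q / p)) (at s)"
      by (intro DERIV_cdivide has_real_derivative_powr)
    moreover have "(1 - q / p) * s powr (1 - q / p - 1) / (1 - q / p) = s powr (- (q / p))"
      using assms by simp
    ultimately show
      "((\<lambda>s. s powr (1 - q / p) / (1 - q / p)) has_real_derivative s powr (- (q / p))) (at s)"
      by metis
  next
    have "1 - q / p < 0" using assms by simp
    then show "((\<lambda>s. s powr (1 - q / p) / (1 - q / p)) \<longlongrightarrow> 0) at_top"
      by (intro tendsto_divide_zero tendsto_neg_powr filterlim_ident)
  qed auto
  also have "0 - t powr (1 - q / p) / (1 - q / p) = p / (q - p) * t powr (1 - q / p)"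
    using assms by (simp add: divide_simps) (simp add: algebra_simps)
  also have "ennreal (M powr q) * ennreal t + ennreal (A powr q) * ennreal \<dots>
      = ennreal (M powr q * t + p / (q - p) * A powr q * t powr (1 - q / p))"
    using assms by (simp add: ennreal_mult[symmetric] mult_ac flip: ennreal_plus)
  finally show ?thesis .
qed

text \<open>
  Optimisation over the splitting point. For \<open>r = q\<close> the second term is the one of the weak-type
  estimate; there \<open>M powr (q - r) = 1\<close> because \<open>M > 0\<close> (while \<open>0 powr 0 = 0\<close>).
\<close>

lemma le_of_split_bounds:
  fixes p r q A M c :: real
  assumes "0 < p" "p < r" "0 \<le> A" "0 < M" "0 \<le> c"
    and I: "\<And>t. 0 < t \<Longrightarrow>
      I \<le> ennreal (M powr q * t + c * M powr (q - r) * A powr r * t powr (1 - r / p))"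
  shows "I \<le> ennreal ((1 + c) * A powr p * M powr (q - p))"
proof (cases "A = 0")
  case True
  \<comment> \<open>The optimal \<open>t\<close> degenerates to \<open>0\<close>; here the second term vanishes and \<open>t\<close> may tend to \<open>0\<close>.\<close>
  have "I \<le> 0 + ennreal e" if "0 < e" for e
    using I[of "e / M powr q"] that True \<open>0 < M\<close> by simp
  then have "I \<le> 0" by - (rule ennreal_le_epsilon)
  then show ?thesis by simp
next
  case False
  then have A: "0 < A" using assms by simp
  define t where "t = (A / M) powr p"
  have t: "0 < t" using A assms by (simp add: t_def)
  have "M powr q * t = A powr p * M powr (q - p)"
    using A assms by (simp add: t_def powr_divide powr_diff)
  moreover have "M powr (q - r) * A powr r * t powr (1 - r / p) = A powr p * M powr (q - p)"
  proof -
    have "t powr (1 - r / p) = (A / M) powr (p - r)"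
      using assms by (simp add: t_def powr_powr algebra_simps)
    also have "\<dots> = A powr (p - r) * M powr (r - p)"
      using A assms by (simp add: powr_divide powr_diff)
    finally have "M powr (q - r) * A powr r * t powr (1 - r / p)
        = (A powr r * A powr (p - r)) * (M powr (q - r) * M powr (r - p))"
      by simp
    then show ?thesis by (simp flip: powr_add)
  qed
  ultimately show ?thesis
    using I[OF t] by (simp add: algebra_simps)
qed

section \<open>From balls to Morrey norms\<close>

lemma ballsE:
  assumes "B \<in> balls"
  obtains "B \<in> sets lebesgue" "emeasure lebesgue B < \<infinity>" "0 < measure lebesgue B"
proof -
  obtain c \<rho> where B: "B = ball c \<rho>" "0 < \<rho>" using assms by (auto simp: balls_def)
  show ?thesis
  proof
    show "B \<in> sets lebesgue" using B by auto
    show "emeasure lebesgue B < \<infinity>" using B emeasure_bounded_finite[of B] by simp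
    show "0 < measure lebesgue B" using B content_ball_pos by simp
  qed
qed

lemma locally_integrable_of_bounded:
  fixes f :: "real ^ 'n \<Rightarrow> 'b::{real_normed_field, euclidean_space}"
  assumes "f \<in> borel_measurable lebesgue" "AE x in lebesgue. norm (f x) \<le> M"
  shows "locally_integrable f"
  unfolding locally_integrable_def
proof (intro allI impI)
  fix K :: "(real ^ 'n) set" assume K: "compact K"
  show "set_integrable lebesgue K f"
    unfolding set_integrable_def
  proof (rule integrableI_bounded_set[where A = K and B = M])
    show "K \<in> sets lebesgue" "emeasure lebesgue K < \<infinity>"
      using K emeasure_compact_finite[OF K] by (auto simp: compact_imp_closed borel_closed)
    then show "(\<lambda>x. indicator K x *\<^sub>R f x) \<in> borel_measurable lebesgue"
      using assms(1) by measurable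
    show "AE x in lebesgue. x \<in> K \<longrightarrow> norm (indicator K x *\<^sub>R f x) \<le> M"
      using assms(2) by eventually_elim (auto split: split_indicator)
  qed auto
qed

text \<open>
  A bound for the rearrangements on balls, with the measure of the ball entering to the power \<open>\<kappa>\<close>,
  gives a Morrey bound. The hypothesis is needed for \<open>M > 0\<close> only: if \<open>M = 0\<close>, all
  rearrangements vanish.
\<close>

lemma morrey_bound_of_rearr_bound:
  fixes f :: "real ^ 'n \<Rightarrow> 'b::{real_normed_field, euclidean_space}"
  assumes "0 < p" "p < q" "0 \<le> C" "0 \<le> M" "0 \<le> N"
    and f: "f \<in> borel_measurable lebesgue" "AE x in lebesgue. norm (f x) \<le> M"
    and ball_bound: "\<And>B. \<lbrakk>B \<in> balls; 0 < M\<rbrakk> \<Longrightarrow>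
       (\<integral>\<^sup>+ s\<in>{0<..}. ennreal (enn2real (rearr_on B f s) powr q) \<partial>lborel)
       \<le> ennreal (C * (N * measure lebesgue B powr (\<kappa> / p)) powr p * M powr (q - p))"
  shows "f \<in> morrey_space q \<kappa>"
    and "morrey_norm q \<kappa> f \<le> ennreal (C powr (1 / q) * N powr (p / q) * M powr (1 - p / q))"
proof -
  show bound: "morrey_norm q \<kappa> f \<le> ennreal (C powr (1 / q) * N powr (p / q) * M powr (1 - p / q))"
    unfolding morrey_norm_def
  proof (rule SUP_least)
    fix B :: "(real ^ 'n) set" assume "B \<in> balls"
    then obtain B: "B \<in> sets lebesgue" "emeasure lebesgue B < \<infinity>" "0 < measure lebesgue B"
      by (rule ballsE)
    let ?m = "measure lebesgue B"
    let ?I = "\<integral>\<^sup>+ y\<in>B. ennreal (norm (f y) powr q) \<partial>lebesgue"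
    have rearr: "rearr_on B f s \<le> ennreal M" for s
      using rearr_on_le[OF B(1) f(1) \<open>0 \<le> M\<close> f(2)] .
    have le: "?I \<le> (\<integral>\<^sup>+ s\<in>{0<..}. ennreal (enn2real (rearr_on B f s) powr q) \<partial>lborel)"
      using assms rearr
      by (intro nn_integral_powr_le_rearr_on B f) (auto intro: le_less_trans[OF rearr])
    have "?I \<le> ennreal (C * (N * ?m powr (\<kappa> / p)) powr p * M powr (q - p))"
    proof (cases "M = 0")
      case True
      then have "rearr_on B f s = 0" for s using rearr[of s] by simp
      then have "?I \<le> 0" using le by simp
      then show ?thesis by simp
    next
      case False
      then show ?thesis using le ball_bound[OF \<open>B \<in> balls\<close>] \<open>0 \<le> M\<close> by auto
    qed
    then have "ennreal (?m powr - \<kappa>) * ?I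
        \<le> ennreal (?m powr - \<kappa>) * ennreal (C * (N * ?m powr (\<kappa> / p)) powr p * M powr (q - p))"
      by (intro mult_left_mono) auto
    also have "\<dots> = ennreal (?m powr - \<kappa> * (C * (N * ?m powr (\<kappa> / p)) powr p * M powr (q - p)))"
      using assms by (simp add: ennreal_mult)
    also have "?m powr - \<kappa> * (C * (N * ?m powr (\<kappa> / p)) powr p * M powr (q - p))
        = C * N powr p * M powr (q - p)"
      using assms B(3) by (simp add: powr_mult powr_powr powr_minus)
    also have "C * N powr p * M powr (q - p)
        = (C powr (1 / q) * N powr (p / q) * M powr (1 - p / q)) powr q"
    proof -
      have "(1 - p / q) * q = q - p" using assms by (simp add: field_simps)
      then show ?thesis using assms by (simp add: powr_mult powr_powr)
    qed
    finally show "(ennreal (?m powr - \<kappa>) * ?I) epowr (1 / q)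
        \<le> ennreal (C powr (1 / q) * N powr (p / q) * M powr (1 - p / q))"
      using assms by (subst epowr_inverse_le_iff) auto
  qed
  show "f \<in> morrey_space q \<kappa>"
    using locally_integrable_of_bounded[OF f] le_less_trans[OF bound]
    by (simp add: morrey_space_def)
qed

lemma lorentz_norm_le_of_lorentz_morrey_norm:
  assumes "lorentz_morrey_norm p r \<kappa> f = ennreal N" "0 \<le> N" "B \<in> balls"
  shows "lorentz_norm p r B f \<le> ennreal (N * measure lebesgue B powr (\<kappa> / p))"
proof -
  let ?m = "measure lebesgue B"
  have m: "0 < ?m" using assms(3) by (rule ballsE)
  have "lorentz_norm p r B f
      = ennreal (?m powr (\<kappa> / p)) * (ennreal (?m powr (- (\<kappa> / p))) * lorentz_norm p r B f)"
    using m by (simp add: mult.assoc[symmetric] ennreal_mult[symmetric] flip: powr_add)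
  also have "\<dots> \<le> ennreal (?m powr (\<kappa> / p)) * ennreal N"
    unfolding assms(1)[symmetric] lorentz_morrey_norm_def
    by (intro mult_left_mono SUP_upper assms) auto
  also have "\<dots> = ennreal (N * ?m powr (\<kappa> / p))"
    using assms by (simp add: ennreal_mult[symmetric] mult.commute)
  finally show ?thesis .
qed

lemma Linfty_norm_bound:
  assumes "Linfty_norm f = ennreal M" "0 \<le> M"
  shows "AE x in lebesgue. norm (f x) \<le> M"
  using esssup_AE[of "\<lambda>x. ennreal (norm (f x))" lebesgue] assms
  by (simp add: Linfty_norm_def)

lemma morrey_bound_strong:
  fixes f :: "real ^ 'n \<Rightarrow> 'b::{real_normed_field, euclidean_space}"
  assumes "0 < p" "p < r" "r < q" "0 \<le> M" "0 \<le> N"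
    and f: "f \<in> borel_measurable lebesgue" "Linfty_norm f = ennreal M"
    and N: "lorentz_morrey_norm p (ereal r) \<kappa> f = ennreal N"
  shows "f \<in> morrey_space q \<kappa>"
    and "morrey_norm q \<kappa> f \<le> ennreal (2 powr (1 / q) * N powr (p / q) * M powr (1 - p / q))"
proof -
  note bdd = Linfty_norm_bound[OF f(2) \<open>0 \<le> M\<close>]
  have key: "(\<integral>\<^sup>+ s\<in>{0<..}. ennreal (enn2real (rearr_on B f s) powr q) \<partial>lborel)
       \<le> ennreal (2 * (N * measure lebesgue B powr (\<kappa> / p)) powr p * M powr (q - p))"
    if "B \<in> balls" "0 < M" for B
  proof -
    let ?A = "N * measure lebesgue B powr (\<kappa> / p)"
    have B: "B \<in> sets lebesgue" using that(1) by (rule ballsE)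
    obtain H where meas: "H \<in> borel_measurable borel" and H0: "\<And>s. 0 \<le> H s"
      and H: "\<And>s. rearr_on B f s = ennreal (H s)" "\<And>s. H s \<le> M"
      using rearr_on_realE[OF B f(1) \<open>0 \<le> M\<close> bdd] by metis
    have "(\<integral>\<^sup>+ s\<in>{0<..}. ennreal ((s powr (1 / p) * H s) powr r) * ennreal (1 / s) \<partial>lborel)
        epowr (1 / r) = lorentz_norm p (ereal r) B f"
      by (simp add: lorentz_norm_def H H0 ennreal_epowr flip: ennreal_mult)
    also have "\<dots> \<le> ennreal ?A"
      by (rule lorentz_norm_le_of_lorentz_morrey_norm[OF N \<open>0 \<le> N\<close> that(1)])
    finally have L: "(\<integral>\<^sup>+ s\<in>{0<..}. ennreal ((s powr (1 / p) * H s) powr r) * ennreal (1 / s)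
        \<partial>lborel) \<le> ennreal (?A powr r)"
      using assms by (subst (asm) epowr_inverse_le_iff) auto
    have "(\<integral>\<^sup>+ s\<in>{0<..}. ennreal (H s powr q) \<partial>lborel)
        \<le> ennreal ((1 + 1) * ?A powr p * M powr (q - p))"
    proof (rule le_of_split_bounds[of p r])
      fix t :: real assume "0 < t"
      then show "(\<integral>\<^sup>+ s\<in>{0<..}. ennreal (H s powr q) \<partial>lborel)
          \<le> ennreal (M powr q * t + 1 * M powr (q - r) * ?A powr r * t powr (1 - r / p))"
        using nn_integral_powr_le_split[OF meas H0 H(2) assms(1-3) _ _ L] \<open>0 \<le> N\<close> by simp
    qed (use assms that in auto)
    then show ?thesis by (simp add: H H0)
  qed
  show "f \<in> morrey_space q \<kappa>"
    and "morrey_norm q \<kappa> f \<le> ennreal (2 powr (1 / q) * N powr (p / q) * M powr (1 - p / q))"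
    using morrey_bound_of_rearr_bound[OF _ _ _ \<open>0 \<le> M\<close> \<open>0 \<le> N\<close> f(1) bdd key] assms by auto
qed

lemma morrey_bound_weak:
  fixes f :: "real ^ 'n \<Rightarrow> 'b::{real_normed_field, euclidean_space}"
  assumes "0 < p" "p < q" "0 \<le> M" "0 \<le> N"
    and f: "f \<in> borel_measurable lebesgue" "Linfty_norm f = ennreal M"
    and N: "lorentz_morrey_norm p \<infinity> \<kappa> f = ennreal N"
  shows "f \<in> morrey_space q \<kappa>"
    and "morrey_norm q \<kappa> f
      \<le> ennreal ((q / (q - p)) powr (1 / q) * N powr (p / q) * M powr (1 - p / q))"
proof -
  note bdd = Linfty_norm_bound[OF f(2) \<open>0 \<le> M\<close>]
  have key: "(\<integral>\<^sup>+ s\<in>{0<..}. ennreal (enn2real (rearr_on B f s) powr q) \<partial>lborel)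
       \<le> ennreal (q / (q - p) * (N * measure lebesgue B powr (\<kappa> / p)) powr p * M powr (q - p))"
    if "B \<in> balls" "0 < M" for B
  proof -
    let ?A = "N * measure lebesgue B powr (\<kappa> / p)"
    have B: "B \<in> sets lebesgue" using that(1) by (rule ballsE)
    obtain H where meas: "H \<in> borel_measurable borel" and H0: "\<And>s. 0 \<le> H s"
      and H: "\<And>s. rearr_on B f s = ennreal (H s)" "\<And>s. H s \<le> M"
      using rearr_on_realE[OF B f(1) \<open>0 \<le> M\<close> bdd] by metis
    have L: "s powr (1 / p) * H s \<le> ?A" if "0 < s" for s
    proof -
      have "ennreal (s powr (1 / p)) * rearr_on B f s \<le> lorentz_norm p \<infinity> B f"
        using that by (auto simp: lorentz_norm_def intro!: SUP_upper)
      also have "\<dots> \<le> ennreal ?A"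
        by (rule lorentz_norm_le_of_lorentz_morrey_norm[OF N \<open>0 \<le> N\<close> \<open>B \<in> balls\<close>])
      finally show ?thesis
        using \<open>0 \<le> N\<close> by (simp add: H H0 flip: ennreal_mult)
    qed
    have "(\<integral>\<^sup>+ s\<in>{0<..}. ennreal (H s powr q) \<partial>lborel)
        \<le> ennreal ((1 + p / (q - p)) * ?A powr p * M powr (q - p))"
    proof (rule le_of_split_bounds[of p q])
      fix t :: real assume "0 < t"
      then show "(\<integral>\<^sup>+ s\<in>{0<..}. ennreal (H s powr q) \<partial>lborel)
          \<le> ennreal (M powr q * t + p / (q - p) * M powr (q - q) * ?A powr q * t powr (1 - q / p))"
        using nn_integral_powr_le_split_weak[OF meas H0 H(2) assms(1,2) _ _ L] \<open>0 \<le> N\<close> \<open>0 < M\<close>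
        by simp
    qed (use assms that in auto)
    moreover have "1 + p / (q - p) = q / (q - p)" using assms by (simp add: field_simps)
    ultimately show ?thesis by (simp add: H H0)
  qed
  show "f \<in> morrey_space q \<kappa>"
    and "morrey_norm q \<kappa> f
      \<le> ennreal ((q / (q - p)) powr (1 / q) * N powr (p / q) * M powr (1 - p / q))"
    using morrey_bound_of_rearr_bound[OF _ _ _ \<open>0 \<le> M\<close> \<open>0 \<le> N\<close> f(1) bdd key] assms by auto
qed

theorem theorem4p1:
  fixes p \<kappa> :: real and r :: ereal
    and f :: "real ^ 'n \<Rightarrow> 'b::{real_normed_field, euclidean_space}"
  assumes "1 \<le> p" and "ereal p < r" and "0 < \<kappa>" and "\<kappa> < 1"
  shows "(r < \<infinity> \<and> f \<in> lorentz_morrey_space p r \<kappa> \<inter> Linfty_space \<longrightarrow>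
           (\<forall>q::real. r < ereal q \<longrightarrow>
              f \<in> morrey_space q \<kappa> \<and>
              morrey_norm q \<kappa> f
                \<le> 2 * (lorentz_morrey_norm p r \<kappa> f epowr (p / q))
                    * (Linfty_norm f epowr (1 - p / q))))
       \<and> (r = \<infinity> \<and> f \<in> lorentz_morrey_space p \<infinity> \<kappa> \<inter> Linfty_space \<longrightarrow>
           (\<forall>q::real. p < q \<longrightarrow>
              f \<in> morrey_space q \<kappa> \<and>
              morrey_norm q \<kappa> f
                \<le> ennreal (2 powr (1 - 1 / q) * (q / (q - p)) powr (1 / q))
                    * (lorentz_morrey_norm p \<infinity> \<kappa> f epowr (p / q))
                    * (Linfty_norm f epowr (1 - p / q))))"
proof (intro conjI[of "_ \<longrightarrow> _"] impI allI)
  fix q :: real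
  assume A: "r < \<infinity> \<and> f \<in> lorentz_morrey_space p r \<kappa> \<inter> Linfty_space" and q: "r < ereal q"
  obtain r' where r: "r = ereal r'" using A assms by (cases r) auto
  have order: "0 < p" "p < r'" "r' < q" "1 \<le> q" using assms q r by auto
  obtain M where M: "Linfty_norm f = ennreal M" "0 \<le> M"
    using A by (cases "Linfty_norm f") (auto simp: Linfty_space_def)
  obtain N where N: "lorentz_morrey_norm p (ereal r') \<kappa> f = ennreal N" "0 \<le> N"
    using A r by (cases "lorentz_morrey_norm p (ereal r') \<kappa> f") (auto simp: lorentz_morrey_space_def)
  have f: "f \<in> borel_measurable lebesgue" using A by (simp add: Linfty_space_def)
  note bound = morrey_bound_strong[OF order(1-3) M(2) N(2) f M(1) N(1)]
  have "2 powr (1 / q) \<le> (2 powr 1 :: real)" using order by (intro powr_mono) auto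
  then have "2 powr (1 / q) * N powr (p / q) * M powr (1 - p / q)
      \<le> 2 * N powr (p / q) * M powr (1 - p / q)"
    by (intro mult_right_mono) auto
  then have "morrey_norm q \<kappa> f \<le> ennreal (2 * N powr (p / q) * M powr (1 - p / q))"
    using bound(2) by (meson ennreal_leI order_trans)
  then show "f \<in> morrey_space q \<kappa> \<and> morrey_norm q \<kappa> f
      \<le> 2 * (lorentz_morrey_norm p r \<kappa> f epowr (p / q)) * (Linfty_norm f epowr (1 - p / q))"
    using bound(1) M N r by (simp add: ennreal_epowr ennreal_mult)
next
  fix q :: real
  assume A: "r = \<infinity> \<and> f \<in> lorentz_morrey_space p \<infinity> \<kappa> \<inter> Linfty_space" and q: "p < q"
  have order: "0 < p" "1 \<le> q" using assms q by auto
  obtain M where M: "Linfty_norm f = ennreal M" "0 \<le> M"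
    using A by (cases "Linfty_norm f") (auto simp: Linfty_space_def)
  obtain N where N: "lorentz_morrey_norm p \<infinity> \<kappa> f = ennreal N" "0 \<le> N"
    using A by (cases "lorentz_morrey_norm p \<infinity> \<kappa> f") (auto simp: lorentz_morrey_space_def)
  have f: "f \<in> borel_measurable lebesgue" using A by (simp add: Linfty_space_def)
  note bound = morrey_bound_weak[OF order(1) q M(2) N(2) f M(1) N(1)]
  let ?c = "(q / (q - p)) powr (1 / q)"
  have "2 powr 0 \<le> (2 powr (1 - 1 / q) :: real)" using order by (intro powr_mono) auto
  then have "?c * 1 \<le> ?c * 2 powr (1 - 1 / q)" by (intro mult_left_mono) auto
  then have "?c * N powr (p / q) * M powr (1 - p / q)
      \<le> 2 powr (1 - 1 / q) * ?c * N powr (p / q) * M powr (1 - p / q)"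
    by (intro mult_right_mono) (auto simp: mult.commute)
  then have "morrey_norm q \<kappa> f
      \<le> ennreal (2 powr (1 - 1 / q) * ?c * N powr (p / q) * M powr (1 - p / q))"
    using bound(2) by (meson ennreal_leI order_trans)
  then show "f \<in> morrey_space q \<kappa> \<and> morrey_norm q \<kappa> f
      \<le> ennreal (2 powr (1 - 1 / q) * (q / (q - p)) powr (1 / q))
        * (lorentz_morrey_norm p \<infinity> \<kappa> f epowr (p / q)) * (Linfty_norm f epowr (1 - p / q))"
    using bound(1) M N by (simp add: ennreal_epowr ennreal_mult)
qed

end
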